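(* Let $J=\begin{pmatrix} 0_n & I_n & 0 \\ I_n & 0_n & 0 \\ 0 & 0 & -1 \end{pmatrix}$, $\mathfrak g=\mathfrak o(2n+1,\mathbb R)=\{X\in\mathfrak{gl}(2n+1,\mathbb R):X^tJ+JX=0\}$, $\mathfrak k=\{X\in\mathfrak g:X^t=-X\}$, and let $K\subset GL(2n+1,\mathbb R)$ be the analytic subgroup with Lie algebra $\mathfrak k$. Let the $F_i$ be the admissible root systems $$F(k,l)=\{e_1+e_2,e_1-e_2,\dots,e_{2k-1}+e_{2k},e_{2k-1}-e_{2k},\ e_{2k+1}-e_{2k+l+1},\dots,e_{2k+l}-e_{2k+2l}\}\quad(k,l\ge0,\ 2k+2l\le n),$$ $$F(k,l)'=F(k,l)\cup\{e_{2k+2l+1}\}\quad(k,l\ge0,\ 2k+2l+1\le n),$$ and for each $i$ let $\mathfrak h_i$ be the Cartan subalgebra of $\mathfrak g$ associated to $F_i$. (a) When $n$ is odd, there are two non-trivial elements of $K$ that fix $\mathfrak h_i$ for every $i$, other than the non-trivial element $J\in K$ (which also fixes every $\mathfrak h_i$). (b) When $n$ is even, there is an element in $K$ that fixes all the Cartan subalgebras $\mathfrak h_i$.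
   Context: $0_n$ and $I_n$ are the $n\times n$ zero and identity matrices and $D(\cdot)$ denotes a diagonal matrix. $\mathfrak m=\{D(h_1,\dots,h_n,-h_1,\dots,-h_n,0):h_i\in\mathbb R\}$ is a Cartan subalgebra of $\mathfrak g$ contained in $\mathfrak p=\{X\in\mathfrak g:X^t=X\}$, and $e_i$ is the functional taking $D(h_1,\dots,h_n,-h_1,\dots,-h_n,0)$ to $h_i$. The roots of $\mathfrak g$ with respect to $\mathfrak m$ are $\pm(e_i\pm e_j)$ ($i<j$) and $\pm e_i$. The Cartan subalgebra associated to an admissible root system $F$ is the standard one whose vector part is $\{X\in\mathfrak m:\alpha(X)=0\ \forall\alpha\in F\}$, namely $\{X\in\mathfrak m:\alpha(X)=0\ \forall\alpha\in F\}\oplus\sum_{\alpha\in F}\mathbb R\,(x_\alpha+x_{-\alpha})$, where $x_\alpha$ spans the one-dimensional root space of $\alpha$ and $x_{-\alpha}=-x_\alpha^t$. An element $x\in K$ fixes $\mathfrak h_i$ if $x\mathfrak h_ix^{-1}=\mathfrak h_i$; non-trivial means different from the identity.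
   Formalization: In (a) the two further elements are claimed only for odd n other than 1: for n=1, K is a circle and only 1 and J fix the Cartan subalgebra of F(0,0); the claims about J are kept. The degenerate n=0 is excluded; in (b) the element is required to be non-trivial. *)

theory Defs
  imports
    Complex_Main
    "HOL-Algebra.Generated_Groups"
    "Jordan_Normal_Form.Matrix"
begin

text \<open>The groups, Lie algebras and functionals depend on a natural number \<open>n\<close>; all matrices
  are real of size \<open>2n+1\<close>. Matrix rows and columns are numbered from \<open>0\<close>, while the functionals
  \<open>e\<^sub>1, \<dots>, e\<^sub>n\<close> keep their numbering from \<open>1\<close>.\<close>

definition J_form :: "nat \<Rightarrow> real mat" where
  "J_form n = four_block_mat
     (four_block_mat (0\<^sub>m n n) (1\<^sub>m n) (1\<^sub>m n) (0\<^sub>m n n)) (0\<^sub>m (2 * n) 1)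
     (0\<^sub>m 1 (2 * n)) (- 1\<^sub>m 1)"

definition lie_g :: "nat \<Rightarrow> real mat set" where
  "lie_g n = {X \<in> carrier_mat (2 * n + 1) (2 * n + 1).
     X\<^sup>T * J_form n + J_form n * X = 0\<^sub>m (2 * n + 1) (2 * n + 1)}"

definition lie_k :: "nat \<Rightarrow> real mat set" where
  "lie_k n = {X \<in> lie_g n. X\<^sup>T = - X}"

definition mat_exp :: "real mat \<Rightarrow> real mat" where
  "mat_exp A = mat (dim_row A) (dim_row A) (\<lambda>(i, j). \<Sum>m. (A ^\<^sub>m m) $$ (i, j) / fact m)"

definition GL :: "nat \<Rightarrow> real mat monoid" where
  "GL d = units_of (ring_mat TYPE(real) d ())"

text \<open>The analytic (connected Lie) subgroup of a matrix group with a given Lie algebra consists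
  of the finite products of exponentials of elements of that algebra.\<close>

definition group_K :: "nat \<Rightarrow> real mat set" where
  "group_K n = generate (GL (2 * n + 1)) (mat_exp ` lie_k n)"

definition cartan_m :: "nat \<Rightarrow> real mat set" where
  "cartan_m n = range (\<lambda>h :: nat \<Rightarrow> real. mat_diag (2 * n + 1)
     (\<lambda>i. if i < n then h (i + 1) else if i < 2 * n then - h (i - n + 1) else 0))"

text \<open>On \<open>cartan_m n\<close> and for \<open>1 \<le> i \<le> n\<close>, the following is the functional reading off \<open>h\<^sub>i\<close>.\<close>

definition e_fun :: "nat \<Rightarrow> real mat \<Rightarrow> real" where
  "e_fun i H = H $$ (i - 1, i - 1)"

definition root_space :: "nat \<Rightarrow> (real mat \<Rightarrow> real) \<Rightarrow> real mat set" where
  "root_space n \<alpha> = {X \<in> lie_g n. \<forall>H \<in> cartan_m n. H * X - X * H = \<alpha> H \<cdot>\<^sub>m X}"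

text \<open>For a root \<open>\<alpha>\<close> with root space spanned by \<open>x\<^sub>\<alpha>\<close>, and with \<open>x\<^sub>-\<^sub>\<alpha> = - x\<^sub>\<alpha>\<^sup>T\<close>, the
  next set is the line \<open>\<real> (x\<^sub>\<alpha> + x\<^sub>-\<^sub>\<alpha>)\<close>, as the lemma after it confirms; it does not depend on
  the choice of \<open>x\<^sub>\<alpha>\<close>.\<close>

definition compact_line :: "nat \<Rightarrow> (real mat \<Rightarrow> real) \<Rightarrow> real mat set" where
  "compact_line n \<alpha> = {X + (- X\<^sup>T) | X. X \<in> root_space n \<alpha>}"

lemma compact_line_spanned:
  assumes x: "x \<in> carrier_mat (2 * n + 1) (2 * n + 1)"
    and span: "root_space n \<alpha> = {c \<cdot>\<^sub>m x | c. True}"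
  shows "compact_line n \<alpha> = {c \<cdot>\<^sub>m (x + (- x\<^sup>T)) | c. True}"
proof -
  have "c \<cdot>\<^sub>m x + (- (c \<cdot>\<^sub>m x)\<^sup>T) = c \<cdot>\<^sub>m (x + (- x\<^sup>T))" for c
    using x by (intro eq_matI) (auto simp: algebra_simps)
  then show ?thesis
    unfolding compact_line_def span by auto metis+
qed

definition cartan_of :: "nat \<Rightarrow> (real mat \<Rightarrow> real) set \<Rightarrow> real mat set" where
  "cartan_of n F =
     {H + finsum (module_mat TYPE(real) (2 * n + 1) (2 * n + 1)) Y F | H Y.
        H \<in> cartan_m n \<and> (\<forall>\<alpha> \<in> F. \<alpha> H = 0) \<and> (\<forall>\<alpha> \<in> F. Y \<alpha> \<in> compact_line n \<alpha>)}"

definition F_sys :: "nat \<Rightarrow> nat \<Rightarrow> (real mat \<Rightarrow> real) set" where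
  "F_sys k l =
     {(\<lambda>H. e_fun (2 * i - 1) H + e_fun (2 * i) H) | i. i \<in> {1..k}} \<union>
     {(\<lambda>H. e_fun (2 * i - 1) H - e_fun (2 * i) H) | i. i \<in> {1..k}} \<union>
     {(\<lambda>H. e_fun (2 * k + j) H - e_fun (2 * k + l + j) H) | j. j \<in> {1..l}}"

definition F_sys' :: "nat \<Rightarrow> nat \<Rightarrow> (real mat \<Rightarrow> real) set" where
  "F_sys' k l = F_sys k l \<union> {e_fun (2 * k + 2 * l + 1)}"

definition admissible_systems :: "nat \<Rightarrow> (real mat \<Rightarrow> real) set set" where
  "admissible_systems n =
     {F_sys k l | k l. 2 * k + 2 * l \<le> n} \<union> {F_sys' k l | k l. 2 * k + 2 * l + 1 \<le> n}"

definition fixes_subalgebra :: "nat \<Rightarrow> real mat \<Rightarrow> real mat set \<Rightarrow> bool" where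
  "fixes_subalgebra n x \<hh> \<longleftrightarrow> (\<lambda>X. x * X * inv\<^bsub>GL (2 * n + 1)\<^esub> x) ` \<hh> = \<hh>"

definition fixes_all_cartans :: "nat \<Rightarrow> real mat \<Rightarrow> bool" where
  "fixes_all_cartans n x \<longleftrightarrow> (\<forall>F \<in> admissible_systems n. fixes_subalgebra n x (cartan_of n F))"

end

theory Submission
  imports Defs
begin

text \<open>A diagonal sign matrix \<open>x = D(\<epsilon>\<^sub>1, \<dots>, \<epsilon>\<^sub>n, \<epsilon>\<^sub>1, \<dots>, \<epsilon>\<^sub>n, 1)\<close> commutes with \<open>\<mm>\<close>, so
  conjugation by \<open>x\<close> preserves every root space and hence fixes every standard Cartan subalgebra.
  Flipping two of the signs \<open>\<epsilon>\<^sub>i\<close> is a rotation by \<open>\<pi>\<close> and therefore lies in \<open>K\<close>; two pairs of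
  signs give the two elements for odd \<open>n \<ge> 3\<close>, and one pair suffices for even \<open>n\<close>.\<close>

section \<open>Exponentials\<close>

text \<open>\<open>Z\<^sup>3 = - Z\<close> makes \<open>Z\<close> an infinitesimal rotation of its range, so that
  \<open>exp (t Z) = 1 + sin t Z + (1 - cos t) Z\<^sup>2\<close>.\<close>

lemma mat_exp_pi:
  assumes Z: "Z \<in> carrier_mat N N" and Z3: "Z * Z * Z = - Z"
  shows "mat_exp (pi \<cdot>\<^sub>m Z) = 1\<^sub>m N + 2 \<cdot>\<^sub>m (Z * Z)"
proof -
  \<comment> \<open>\<open>P\<close> is the projection onto the kernel of \<open>Z\<close>, while
    \<open>- (Z * Z)\<close> is the projection onto its range.\<close>
  define P where "P = 1\<^sub>m N + Z * Z"
  have P: "P \<in> carrier_mat N N" and ZZ: "Z * Z \<in> carrier_mat N N"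
    using Z by (auto simp: P_def)
  have PZ: "P * Z = 0\<^sub>m N N"
    unfolding P_def using Z ZZ by (subst add_mult_distrib_mat[where nr=N and n=N and nc=N]) (auto simp: Z3)
  \<comment> \<open>Multiplying a Taylor coefficient by \<open>fact m\<close> leaves only its sign
    or 0, which gives the powers of a quarter turn. The \<open>P\<close> term occurs at
    \<open>m = 0\<close> alone: the identity is \<open>P\<close> minus \<open>Z * Z\<close>, and
    \<open>PZ\<close> kills \<open>P\<close> in every later power.\<close>
  have pow: "(pi \<cdot>\<^sub>m Z) ^\<^sub>m m = (if m = 0 then 1 else 0) \<cdot>\<^sub>m P
      + ((fact m * sin_coeff m * pi ^ m) \<cdot>\<^sub>m Z + (- (fact m * cos_coeff m * pi ^ m)) \<cdot>\<^sub>m (Z * Z))" for m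
  proof (induction m)
    case 0
    show ?case
      using Z ZZ by (intro eq_matI) (auto simp: P_def sin_coeff_def cos_coeff_def)
  next
    case (Suc m)
    let ?s = "fact m * sin_coeff m * pi ^ m" and ?c = "- (fact m * cos_coeff m * pi ^ m)"
    have "(pi \<cdot>\<^sub>m Z) ^\<^sub>m Suc m = pi \<cdot>\<^sub>m (((if m = 0 then 1 else 0) \<cdot>\<^sub>m P + (?s \<cdot>\<^sub>m Z + ?c \<cdot>\<^sub>m (Z * Z))) * Z)"
      using Z ZZ P by (simp add: Suc.IH mult_smult_distrib[where nr=N and n=N and nc=N])
    also have "((if m = 0 then 1 else 0) \<cdot>\<^sub>m P + (?s \<cdot>\<^sub>m Z + ?c \<cdot>\<^sub>m (Z * Z))) * Z
        = (if m = 0 then 1 else 0) \<cdot>\<^sub>m (P * Z) + (?s \<cdot>\<^sub>m (Z * Z) + ?c \<cdot>\<^sub>m (Z * Z * Z))"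
      using Z ZZ P
      by (simp add: add_mult_distrib_mat[where nr=N and n=N and nc=N]
          mult_smult_assoc_mat[where nr=N and n=N and nc=N])
    finally have step: "(pi \<cdot>\<^sub>m Z) ^\<^sub>m Suc m = pi \<cdot>\<^sub>m (?s \<cdot>\<^sub>m (Z * Z) + ?c \<cdot>\<^sub>m (- Z))"
      using Z ZZ by (simp add: PZ Z3)
    \<comment> \<open>The rules sin' = cos and cos' = - sin, read off the coefficients.\<close>
    have "fact (Suc m) * sin_coeff (Suc m) = fact m * cos_coeff m"
      and "fact (Suc m) * cos_coeff (Suc m) = - (fact m * sin_coeff m)"
      by (simp_all add: sin_coeff_Suc cos_coeff_Suc field_simps del: of_nat_Suc)
    then show ?case
      unfolding step using Z ZZ P
      by (intro eq_matI) (simp_all add: algebra_simps del: index_mult_mat(1) fact_Suc)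
  qed
  show ?thesis
  proof (rule eq_matI)
    fix i j assume "i < dim_row (1\<^sub>m N + 2 \<cdot>\<^sub>m (Z * Z))" and "j < dim_col (1\<^sub>m N + 2 \<cdot>\<^sub>m (Z * Z))"
    then have ij: "i < N" "j < N" using Z by auto
    have entry: "((pi \<cdot>\<^sub>m Z) ^\<^sub>m m) $$ (i, j) / fact m = (if m = 0 then P $$ (i, j) else 0)
        + (sin_coeff m * pi ^ m * Z $$ (i, j) - cos_coeff m * pi ^ m * (Z * Z) $$ (i, j))" for m
      unfolding pow using ij Z ZZ P by (auto simp: field_simps simp del: index_mult_mat(1))
    have "(\<lambda>m. if m = 0 then P $$ (i, j) else 0) sums P $$ (i, j)"
      by (rule sums_single)
    \<comment> \<open>The angle pi enters here: sin pi = 0 and cos pi = -1 leave P + Z^2 = 1 + 2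
      Z^2.\<close>
    moreover have "(\<lambda>m. sin_coeff m * pi ^ m) sums 0" "(\<lambda>m. cos_coeff m * pi ^ m) sums (- 1)"
      using sin_converges[of pi] cos_converges[of pi] by simp_all
    ultimately have "(\<lambda>m. ((pi \<cdot>\<^sub>m Z) ^\<^sub>m m) $$ (i, j) / fact m) sums
        (P $$ (i, j) + (0 * Z $$ (i, j) - (- 1) * (Z * Z) $$ (i, j)))"
      unfolding entry by (intro sums_add sums_diff sums_mult2)
    then show "mat_exp (pi \<cdot>\<^sub>m Z) $$ (i, j) = (1\<^sub>m N + 2 \<cdot>\<^sub>m (Z * Z)) $$ (i, j)"
      using ij Z by (auto simp: mat_exp_def P_def sums_iff simp del: index_mult_mat(1))
  qed (use Z in \<open>auto simp: mat_exp_def\<close>)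
qed

section \<open>Monomial matrices\<close>

text \<open>One scalar and one column index per row cover diagonal matrices, the form J and rotation
  generators alike. The scalars may vanish, and \<open>\<rho>\<close> need not be a
  permutation.\<close>

definition monomial_mat :: "nat \<Rightarrow> (nat \<Rightarrow> real) \<Rightarrow> (nat \<Rightarrow> nat) \<Rightarrow> real mat" where
  "monomial_mat N r \<rho> = mat N N (\<lambda>(i, j). if j = \<rho> i then r i else 0)"

lemma monomial_mat_carrier [simp]: "monomial_mat N r \<rho> \<in> carrier_mat N N"
  and dim_row_monomial_mat [simp]: "dim_row (monomial_mat N r \<rho>) = N"
  and dim_col_monomial_mat [simp]: "dim_col (monomial_mat N r \<rho>) = N"
  by (auto simp: monomial_mat_def)

lemma index_monomial_mat [simp]:
  "i < N \<Longrightarrow> j < N \<Longrightarrow> monomial_mat N r \<rho> $$ (i, j) = (if j = \<rho> i then r i else 0)"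
  by (simp add: monomial_mat_def)

lemma mat_diag_monomial: "mat_diag N d = monomial_mat N d (\<lambda>i. i)"
  by (rule eq_matI) (auto simp: mat_diag_def)

text \<open>Only the term \<open>k = \<rho> i\<close> of the scalar product survives, so products
  with a monomial left factor reduce to case distinctions on indices.\<close>

lemma index_monomial_mult:
  assumes "X \<in> carrier_mat N M" "i < N" "j < M" "\<rho> i < N"
  shows "(monomial_mat N r \<rho> * X) $$ (i, j) = r i * X $$ (\<rho> i, j)"
proof -
  have "(monomial_mat N r \<rho> * X) $$ (i, j)
      = (\<Sum>k\<in>{0..<N}. (if k = \<rho> i then r i else 0) * X $$ (k, j))"
    using assms by (auto simp: scalar_prod_def intro!: sum.cong)
  also have "\<dots> = (\<Sum>k\<in>{0..<N}. if k = \<rho> i then r i * X $$ (k, j) else 0)"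
    by (intro sum.cong) auto
  finally show ?thesis using assms by simp
qed

section \<open>The form J as a monomial matrix\<close>

definition J_perm :: "nat \<Rightarrow> nat \<Rightarrow> nat" where
  "J_perm n i = (if i < n then i + n else if i < 2 * n then i - n else i)"

lemma J_form_monomial:
  "J_form n = monomial_mat (2 * n + 1) (\<lambda>i. if i < 2 * n then 1 else - 1) (J_perm n)"
  by (rule eq_matI) (auto simp: J_form_def J_perm_def)

lemma J_form_carrier: "J_form n \<in> carrier_mat (2 * n + 1) (2 * n + 1)"
  by (simp add: J_form_monomial)

lemmas J_form_carrier_Suc [simp] = J_form_carrier[simplified]

lemma dim_row_J_form [simp]: "dim_row (J_form n) = 2 * n + 1"
  and dim_col_J_form [simp]: "dim_col (J_form n) = 2 * n + 1"
  by (simp_all add: J_form_monomial)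

lemma J_form_mult_J_form: "J_form n * J_form n = 1\<^sub>m (2 * n + 1)"
proof (rule eq_matI)
  fix i j assume "i < dim_row (1\<^sub>m (2 * n + 1) :: real mat)" "j < dim_col (1\<^sub>m (2 * n + 1) :: real mat)"
  then show "(J_form n * J_form n) $$ (i, j) = 1\<^sub>m (2 * n + 1) $$ (i, j)"
    unfolding J_form_monomial
    by (subst index_monomial_mult[where M="2 * n + 1"]) (auto simp: J_perm_def)
qed (auto simp: J_form_monomial)

lemma transpose_J_form: "(J_form n)\<^sup>T = J_form n"
  unfolding J_form_monomial by (rule eq_matI) (auto simp: J_perm_def)

lemma J_form_neq_one: "1 \<le> n \<Longrightarrow> J_form n \<noteq> 1\<^sub>m (2 * n + 1)"
proof
  assume "1 \<le> n" "J_form n = 1\<^sub>m (2 * n + 1)"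
  then have "J_form n $$ (2 * n, 2 * n) = (1::real)" by simp
  then show False by (simp add: J_form_monomial J_perm_def)
qed

section \<open>Elements of \<open>K\<close>\<close>

text \<open>For skew \<open>Z\<close> the equation defining the Lie algebra says that
  \<open>Z\<close> commutes with J. Hence \<open>pi \<cdot>\<^sub>m Z\<close> lies in
  \<open>lie_k n\<close>, and its exponential is -1 on the range of \<open>Z\<close> and 1 on the
  kernel.\<close>

lemma exp_pi_in_group_K:
  assumes Z: "Z \<in> carrier_mat (2 * n + 1) (2 * n + 1)" and Z3: "Z * Z * Z = - Z"
    and skew: "Z\<^sup>T = - Z" and comm: "J_form n * Z = Z * J_form n"
  shows "1\<^sub>m (2 * n + 1) + 2 \<cdot>\<^sub>m (Z * Z) \<in> group_K n"
proof -
  let ?N = "2 * n + 1"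
  have "(pi \<cdot>\<^sub>m Z)\<^sup>T = - (pi \<cdot>\<^sub>m Z)"
  proof -
    have "(pi \<cdot>\<^sub>m Z)\<^sup>T = pi \<cdot>\<^sub>m Z\<^sup>T" by (rule eq_matI) auto
    then show ?thesis unfolding skew by (intro eq_matI) auto
  qed
  moreover have "- (pi \<cdot>\<^sub>m Z) * J_form n + J_form n * (pi \<cdot>\<^sub>m Z) = 0\<^sub>m ?N ?N"
  proof -
    have "- (pi \<cdot>\<^sub>m Z) * J_form n = - (pi \<cdot>\<^sub>m (Z * J_form n))"
      using Z J_form_carrier[of n] by (simp add: mult_smult_assoc_mat[where nr="?N" and n="?N" and nc="?N"])
    moreover have "J_form n * (pi \<cdot>\<^sub>m Z) = pi \<cdot>\<^sub>m (Z * J_form n)"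
      using Z J_form_carrier[of n] comm by (simp add: mult_smult_distrib[where nr="?N" and n="?N" and nc="?N"])
    ultimately show ?thesis
      using Z J_form_carrier[of n] by (simp add: uminus_l_inv_mat[where nr="?N" and nc="?N"])
  qed
  ultimately have "pi \<cdot>\<^sub>m Z \<in> lie_k n"
    using Z by (simp add: lie_k_def lie_g_def)
  then have "mat_exp (pi \<cdot>\<^sub>m Z) \<in> group_K n"
    unfolding group_K_def by (intro generate.incl imageI)
  then show ?thesis by (simp only: mat_exp_pi[OF Z Z3])
qed

section \<open>Flipping two signs by a rotation\<close>

definition flip_sign :: "nat \<Rightarrow> nat \<Rightarrow> nat \<Rightarrow> nat \<Rightarrow> real" where
  "flip_sign n p q i = (if i \<in> {p, q, n + p, n + q} then - 1 else 1)"

abbreviation flip_mat :: "nat \<Rightarrow> nat \<Rightarrow> nat \<Rightarrow> real mat" where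
  "flip_mat n p q \<equiv> monomial_mat (2 * n + 1) (flip_sign n p q) (\<lambda>i. i)"

text \<open>The generator \<open>W\<close> is the quarter turn in the planes (p, q) and (n + p, n +
  q), with the same orientation in both. Turning both planes together is what makes it commute with
  J. Its square is -1 on these four coordinates and 0 on the others.\<close>

lemma flip_mat_in_group_K:
  assumes pq: "p < q" "q < n"
  shows "flip_mat n p q \<in> group_K n"
proof -
  let ?N = "2 * n + 1"
  define \<rho> where "\<rho> i = (if i = p then q else if i = q then p
    else if i = n + p then n + q else if i = n + q then n + p else i)" for i
  define r :: "nat \<Rightarrow> real" where "r i = (if i \<in> {p, n + p} then 1
    else if i \<in> {q, n + q} then - 1 else 0)" for i
  define W where "W = monomial_mat ?N r \<rho>"
  have W: "W \<in> carrier_mat ?N ?N" by (simp add: W_def)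
  have \<rho>: "\<rho> i < ?N" if "i < ?N" for i
    using that pq by (auto simp: \<rho>_def)
  have WW: "(W * W) $$ (i, j) = (if i = j then - (r i)\<^sup>2 else 0)" if "i < ?N" "j < ?N" for i j
    unfolding W_def using that pq \<rho>[OF that(1)]
    by (subst index_monomial_mult[where M="?N"]) (auto simp: \<rho>_def r_def)
  \<comment> \<open>Bracketed to the right so that the left factor is monomial; \<open>WW\<close>
    then supplies the entries of the other factor.\<close>
  have "W * (W * W) = - W"
  proof (rule eq_matI)
    fix i j assume "i < dim_row (- W)" "j < dim_col (- W)"
    then have ij: "i < ?N" "j < ?N" using W by auto
    have "(W * (W * W)) $$ (i, j) = r i * (W * W) $$ (\<rho> i, j)"
      using ij \<rho>[OF ij(1)] W unfolding W_def by (subst index_monomial_mult[where M="?N"]) auto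
    then show "(W * (W * W)) $$ (i, j) = (- W) $$ (i, j)"
      using ij pq \<rho>[OF ij(1)] W by (simp add: WW del: index_mult_mat(1)) (auto simp: W_def \<rho>_def r_def)
  qed (use W in auto)
  then have W3: "W * W * W = - W"
    using W by (simp add: assoc_mult_mat[where ?n\<^sub>1="?N" and ?n\<^sub>2="?N" and ?n\<^sub>3="?N" and ?n\<^sub>4="?N"])
  have skew: "W\<^sup>T = - W"
    using pq by (intro eq_matI) (auto simp: W_def \<rho>_def r_def)
  have comm: "J_form n * W = W * J_form n"
  proof (rule eq_matI)
    fix i j assume "i < dim_row (W * J_form n)" "j < dim_col (W * J_form n)"
    then have ij: "i < ?N" "j < ?N" by (auto simp: W_def J_form_monomial)
    have J: "J_perm n i < ?N" using ij by (auto simp: J_perm_def)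
    show "(J_form n * W) $$ (i, j) = (W * J_form n) $$ (i, j)"
      unfolding J_form_monomial W_def
      using ij pq J \<rho>[OF ij(1)]
      by (simp add: index_monomial_mult[where M="?N"] del: index_mult_mat(1))
        (auto simp: J_perm_def \<rho>_def r_def)
  qed (auto simp: W_def J_form_monomial)
  have "1\<^sub>m ?N + 2 \<cdot>\<^sub>m (W * W) = flip_mat n p q"
    using W pq by (intro eq_matI) (auto simp: WW r_def flip_sign_def simp del: index_mult_mat(1))
  then show ?thesis
    using exp_pi_in_group_K[OF W W3 skew comm] by simp
qed

text \<open>The \<open>-1\<close> eigenspace of \<open>J\<close> has dimension \<open>n + 1\<close>; for odd \<open>n\<close> it carries an orthogonal complex
  structure \<open>A\<close>, and \<open>J\<close> is the exponential of \<open>\<pi> A\<close> extended by \<open>0\<close>. The columns of \<open>U\<close> are an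
  orthonormal basis of that eigenspace.\<close>

lemma J_form_in_group_K:
  assumes "odd n"
  shows "J_form n \<in> group_K n"
proof -
  let ?N = "2 * n + 1" and ?M = "n + 1"
  \<comment> \<open>The indices 0 and 1, 2 and 3, and so on are paired, and \<open>A\<close> is a
    quarter turn in each resulting plane. As \<open>n\<close> is odd, the n + 1 indices pair off
    completely, so \<open>\<rho>\<close> stays in range.\<close>
  define \<rho> where "\<rho> i = (if even i then i + 1 else i - 1)" for i :: nat
  define A where "A = monomial_mat ?M (\<lambda>i. if even i then - 1 else 1) \<rho>"
  have \<rho>: "\<rho> i < ?M" if "i < ?M" for i
    using that assms by (cases "i = n") (auto simp: \<rho>_def)
  have A: "A \<in> carrier_mat ?M ?M" by (simp add: A_def)
  have AA: "A * A = - 1\<^sub>m ?M"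
  proof (rule eq_matI)
    fix i j assume "i < dim_row (- 1\<^sub>m ?M :: real mat)" "j < dim_col (- 1\<^sub>m ?M :: real mat)"
    then have ij: "i < ?M" "j < ?M" by auto
    have "(A * A) $$ (i, j) = (if even i then - 1 else 1) * A $$ (\<rho> i, j)"
      unfolding A_def using ij \<rho>[OF ij(1)] by (subst index_monomial_mult[where M="?M"]) auto
    then show "(A * A) $$ (i, j) = (- 1\<^sub>m ?M) $$ (i, j)"
      using ij \<rho>[OF ij(1)] by (auto simp: A_def \<rho>_def elim!: oddE)
  qed (auto simp: A_def)
  have At: "A\<^sup>T = - A"
    by (rule eq_matI) (auto simp: A_def \<rho>_def elim!: oddE)
  define c :: real where "c = 1 / sqrt 2"
  have cc: "c * c = 1 / 2" by (simp add: c_def)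
  \<comment> \<open>Column j < n of \<open>U\<close> is the difference of the basis vectors j and n
    + j, scaled by \<open>c\<close> to unit length; column n is the last basis vector.\<close>
  define u where "u i j = (if i < n then (if i = j then c else 0)
    else if i < 2 * n then (if i = n + j then - c else 0) else (if j = n then 1 else 0))" for i j
  define U where "U = mat ?N ?M (\<lambda>(i, j). u i j)"
  have U: "U \<in> carrier_mat ?N ?M" and Ut: "U\<^sup>T \<in> carrier_mat ?M ?N"
    by (auto simp: U_def)
  have UtU: "U\<^sup>T * U = 1\<^sub>m ?M"
  proof (rule eq_matI)
    fix i j assume "i < dim_row (1\<^sub>m ?M :: real mat)" "j < dim_col (1\<^sub>m ?M :: real mat)"
    then have ij: "i < ?M" "j < ?M" by auto
    have "(U\<^sup>T * U) $$ (i, j) = (\<Sum>k\<in>{0..<?N}. u k i * u k j)"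
      using ij by (auto simp: U_def scalar_prod_def intro!: sum.cong)
    also have "\<dots> = (\<Sum>k\<in>{0..<n}. u k i * u k j) + (\<Sum>k\<in>{0..<n}. u (k + n) i * u (k + n) j) + u (2 * n) i * u (2 * n) j"
    proof -
      have "(\<Sum>k\<in>{0..<2 * n}. u k i * u k j) = (\<Sum>k\<in>{0..<n}. u k i * u k j) + (\<Sum>k\<in>{n..<2 * n}. u k i * u k j)"
        by (subst sum.atLeastLessThan_concat) auto
      moreover have "(\<Sum>k\<in>{n..<2 * n}. u k i * u k j) = (\<Sum>k\<in>{0..<n}. u (k + n) i * u (k + n) j)"
        using sum.shift_bounds_nat_ivl[of "\<lambda>k. u k i * u k j" 0 n n] by (simp add: mult_2)
      ultimately show ?thesis by simp
    qed
    also have "(\<Sum>k\<in>{0..<n}. u k i * u k j) = (\<Sum>k\<in>{0..<n}. if k = i then (if i = j then 1 / 2 else 0) else 0)"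
      by (intro sum.cong) (auto simp: u_def cc)
    also have "(\<Sum>k\<in>{0..<n}. u (k + n) i * u (k + n) j) = (\<Sum>k\<in>{0..<n}. if k = i then (if i = j then 1 / 2 else 0) else 0)"
      by (intro sum.cong) (auto simp: u_def cc)
    finally show "(U\<^sup>T * U) $$ (i, j) = 1\<^sub>m ?M $$ (i, j)"
      using ij by (auto simp: u_def)
  qed (auto simp: U_def)
  have JU: "J_form n * U = - U"
  proof (rule eq_matI)
    fix i j assume "i < dim_row (- U)" "j < dim_col (- U)"
    then have ij: "i < ?N" "j < ?M" using U by auto
    then show "(J_form n * U) $$ (i, j) = (- U) $$ (i, j)"
      unfolding J_form_monomial using U
      by (subst index_monomial_mult[where M="?M"]) (auto simp: J_perm_def U_def u_def)
  qed (use U in \<open>auto simp: J_form_monomial\<close>)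
  have UtJ: "U\<^sup>T * J_form n = - U\<^sup>T"
  proof -
    have "(J_form n * U)\<^sup>T = U\<^sup>T * J_form n"
      by (subst transpose_mult[OF J_form_carrier U]) (simp add: transpose_J_form)
    moreover have "(- U)\<^sup>T = - U\<^sup>T" by (rule eq_matI) auto
    ultimately show ?thesis by (simp add: JU)
  qed
  \<comment> \<open>The product \<open>U * U\<^sup>T\<close> is the orthogonal projection onto the
    -1 eigenspace, and a symmetric involution is 1 minus twice that projection.\<close>
  have UUt: "1\<^sub>m ?N + 2 \<cdot>\<^sub>m (- (U * U\<^sup>T)) = J_form n"
  proof (rule eq_matI)
    fix i j assume "i < dim_row (J_form n)" "j < dim_col (J_form n)"
    then have ij: "i < ?N" "j < ?N" by (auto simp: J_form_monomial)
    \<comment> \<open>The only column in which row \<open>i\<close> of \<open>U\<close> has a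
      nonzero entry.\<close>
    define i' where "i' = (if i < n then i else if i < 2 * n then i - n else n)"
    have "(U * U\<^sup>T) $$ (i, j) = (\<Sum>k\<in>{0..<?M}. u i k * u j k)"
      using ij by (auto simp: U_def scalar_prod_def intro!: sum.cong)
    also have "\<dots> = (\<Sum>k\<in>{0..<?M}. if k = i' then u i k * u j k else 0)"
      using ij by (intro sum.cong) (auto simp: u_def i'_def)
    also have "\<dots> = u i i' * u j i'"
      using ij by (auto simp: i'_def)
    finally show "(1\<^sub>m ?N + 2 \<cdot>\<^sub>m (- (U * U\<^sup>T))) $$ (i, j) = J_form n $$ (i, j)"
      using ij U by (auto simp: J_form_monomial J_perm_def u_def i'_def cc simp del: index_mult_mat(1))
  qed (use U in \<open>auto simp: J_form_monomial\<close>)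
  define Z where "Z = U * A * U\<^sup>T"
  have Z: "Z \<in> carrier_mat ?N ?N" using U A by (auto simp: Z_def)
  have ZU: "Z * U = U * A"
  proof -
    have "Z * U = U * A * (U\<^sup>T * U)"
      unfolding Z_def using U A Ut by (intro assoc_mult_mat) auto
    then show ?thesis using U A by (simp add: UtU)
  qed
  \<comment> \<open>By \<open>ZU\<close>, \<open>Z\<close> acts on the range of \<open>U\<close> as
    \<open>A\<close> does, so \<open>AA\<close> turns its square into minus the projection.\<close>
  have ZZ: "Z * Z = - (U * U\<^sup>T)"
  proof -
    have "Z * Z = Z * (U * A) * U\<^sup>T"
      using Z U A Ut unfolding Z_def[symmetric]
      by (subst (2) Z_def, intro assoc_mult_mat[symmetric]) auto
    also have "Z * (U * A) = Z * U * A"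
      using Z U A by (intro assoc_mult_mat[symmetric]) auto
    also have "\<dots> = U * (A * A)"
      unfolding ZU using U A by (intro assoc_mult_mat) auto
    also have "\<dots> = - U"
      using U by (simp add: AA)
    finally show ?thesis using U by simp
  qed
  have Z3: "Z * Z * Z = - Z"
  proof -
    have "Z * Z * Z = Z * (Z * Z)"
      using Z by (intro assoc_mult_mat) auto
    also have "\<dots> = - (Z * (U * U\<^sup>T))"
      using Z U by (simp add: ZZ)
    also have "Z * (U * U\<^sup>T) = Z * U * U\<^sup>T"
      using Z U Ut by (intro assoc_mult_mat[symmetric]) auto
    finally show ?thesis by (simp add: ZU flip: Z_def)
  qed
  have skew: "Z\<^sup>T = - Z"
  proof -
    have "Z\<^sup>T = U * (U * A)\<^sup>T"
      unfolding Z_def using U A Ut by (subst transpose_mult) auto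
    also have "(U * A)\<^sup>T = A\<^sup>T * U\<^sup>T"
      using U A by (rule transpose_mult)
    also have "\<dots> = - (A * U\<^sup>T)"
      using A Ut by (simp add: At)
    also have "U * - (A * U\<^sup>T) = - (U * A * U\<^sup>T)"
      using U A Ut by (simp add: assoc_mult_mat[OF U A Ut])
    finally show ?thesis by (simp add: Z_def)
  qed
  \<comment> \<open>The columns of \<open>Z\<close> lie in the -1 eigenspace of J, and so do its
    rows. Both products with J are therefore \<open>- Z\<close>, which gives commutation.\<close>
  have "J_form n * Z = - Z"
  proof -
    have "J_form n * Z = J_form n * (U * A) * U\<^sup>T"
      unfolding Z_def using U A Ut by (intro assoc_mult_mat[symmetric, OF J_form_carrier]) auto
    also have "J_form n * (U * A) = J_form n * U * A"
      using U A by (intro assoc_mult_mat[symmetric, OF J_form_carrier]) auto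
    finally show ?thesis using U A Ut by (simp add: JU Z_def)
  qed
  moreover have "Z * J_form n = - Z"
  proof -
    have "Z * J_form n = U * A * (U\<^sup>T * J_form n)"
      unfolding Z_def using U A Ut by (intro assoc_mult_mat[OF _ _ J_form_carrier]) auto
    then show ?thesis using U A Ut by (simp add: UtJ Z_def)
  qed
  ultimately show ?thesis
    using exp_pi_in_group_K[OF Z Z3 skew] by (simp only: ZZ UUt)
qed

section \<open>Involutions fixing Cartan subalgebras\<close>

text \<open>All elements considered here square to 1, so conjugation takes the form
  \<open>x * X * x\<close> and no inverse has to be computed.\<close>

lemma inv_GL_involution:
  assumes x: "x \<in> carrier_mat N N" "x * x = 1\<^sub>m N"
  shows "inv\<^bsub>GL N\<^esub> x = x"
proof -
  interpret R: ring "ring_mat TYPE(real) N ()" by (rule ring_mat)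
  interpret G: group "GL N" unfolding GL_def by (rule R.units_group)
  have "x \<in> carrier (GL N)"
    using x unfolding GL_def units_of_def Units_def by (auto simp: ring_mat_def)
  moreover have "x \<otimes>\<^bsub>GL N\<^esub> x = \<one>\<^bsub>GL N\<^esub>"
    using x by (simp add: GL_def units_of_def ring_mat_def)
  ultimately show ?thesis by (simp add: G.inv_equality)
qed

lemma conj_involution:
  fixes x :: "real mat"
  assumes x: "x \<in> carrier_mat N N" "x * x = 1\<^sub>m N" and X: "X \<in> carrier_mat N N"
  shows "x * (x * X * x) * x = X"
proof -
  have "x * (x * X * x) = x * (x * X) * x"
    using x X by (intro assoc_mult_mat[symmetric]) auto
  also have "x * (x * X) = x * x * X"
    using x(1) X by (intro assoc_mult_mat[symmetric]) auto
  also have "\<dots> * x = X * x" using x X by simp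
  also have "X * x * x = X * (x * x)" using x X by (intro assoc_mult_mat) auto
  finally show ?thesis using x X by simp
qed

lemma conj_add:
  fixes x :: "real mat"
  assumes "x \<in> carrier_mat N N" "A \<in> carrier_mat N N" "B \<in> carrier_mat N N"
  shows "x * (A + B) * x = x * A * x + x * B * x"
  using assms by (simp add: mult_add_distrib_mat[where nr=N and n=N and nc=N]
      add_mult_distrib_mat[where nr=N and n=N and nc=N])

text \<open>Conjugation is additive, so it passes through the compact part of an element of
  \<open>cartan_of\<close>. Membership in the carrier is carried through the induction because the
  additivity step uses it for the partial sums.\<close>

lemma conj_finsum:
  fixes Y :: "'a \<Rightarrow> real mat"
  assumes x: "x \<in> carrier_mat N N" and "finite F" and Y: "\<And>\<alpha>. \<alpha> \<in> F \<Longrightarrow> Y \<alpha> \<in> carrier_mat N N"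
  shows "finsum (module_mat TYPE(real) N N) Y F \<in> carrier_mat N N \<and>
    x * finsum (module_mat TYPE(real) N N) Y F * x = finsum (module_mat TYPE(real) N N) (\<lambda>\<alpha>. x * Y \<alpha> * x) F"
proof -
  interpret M: abelian_group "module_mat TYPE(real) N N" by (rule abelian_group_mat)
  show ?thesis
    using \<open>finite F\<close> Y
  proof (induction F)
    case empty
    then show ?case
      using x by (simp add: M.finsum_empty module_mat_simps)
  next
    case (insert \<alpha> F)
    let ?S = "finsum (module_mat TYPE(real) N N) Y F"
    have S: "?S \<in> carrier_mat N N" and Ya: "Y \<alpha> \<in> carrier_mat N N" using insert by auto
    have *: "finsum (module_mat TYPE(real) N N) Y (insert \<alpha> F) = Y \<alpha> + ?S"
      using insert by (subst M.finsum_insert) (auto simp: module_mat_simps)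
    have **: "finsum (module_mat TYPE(real) N N) (\<lambda>\<alpha>. x * Y \<alpha> * x) (insert \<alpha> F)
        = x * Y \<alpha> * x + finsum (module_mat TYPE(real) N N) (\<lambda>\<alpha>. x * Y \<alpha> * x) F"
      using insert x by (subst M.finsum_insert) (auto simp: module_mat_simps)
    have "x * (Y \<alpha> + ?S) * x = x * Y \<alpha> * x + x * ?S * x"
      by (rule conj_add[OF x Ya S])
    then show ?case using S Ya insert by (simp add: * **)
  qed
qed

lemma cartan_m_carrier: "H \<in> cartan_m n \<Longrightarrow> H \<in> carrier_mat (2 * n + 1) (2 * n + 1)"
  by (auto simp: cartan_m_def)

lemma compact_line_carrier:
  "Y \<in> compact_line n \<alpha> \<Longrightarrow> Y \<in> carrier_mat (2 * n + 1) (2 * n + 1)"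
  by (auto simp: compact_line_def root_space_def lie_g_def)

text \<open>It suffices to map the vector part and each compact line into itself: this gives one
  inclusion, and the other follows because \<open>x\<close> is its own inverse.\<close>

lemma fixes_cartan_of:
  assumes x: "x \<in> carrier_mat (2 * n + 1) (2 * n + 1)" "x * x = 1\<^sub>m (2 * n + 1)" and F: "finite F"
    and m: "\<And>H. H \<in> cartan_m n \<Longrightarrow> \<forall>\<alpha>\<in>F. \<alpha> H = 0 \<Longrightarrow>
      x * H * x \<in> cartan_m n \<and> (\<forall>\<alpha>\<in>F. \<alpha> (x * H * x) = 0)"
    and l: "\<And>\<alpha> Y. \<alpha> \<in> F \<Longrightarrow> Y \<in> compact_line n \<alpha> \<Longrightarrow> x * Y * x \<in> compact_line n \<alpha>"
  shows "fixes_subalgebra n x (cartan_of n F)"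
proof -
  let ?N = "2 * n + 1"
  have sub: "x * X * x \<in> cartan_of n F \<and> X \<in> carrier_mat ?N ?N" if "X \<in> cartan_of n F" for X
  proof -
    from that obtain H Y where X: "X = H + finsum (module_mat TYPE(real) ?N ?N) Y F"
      and H: "H \<in> cartan_m n" "\<forall>\<alpha>\<in>F. \<alpha> H = 0" and Y: "\<forall>\<alpha>\<in>F. Y \<alpha> \<in> compact_line n \<alpha>"
      by (auto simp: cartan_of_def)
    let ?S = "finsum (module_mat TYPE(real) ?N ?N) Y F"
    note S = conj_finsum[OF x(1) F, of Y, OF compact_line_carrier[OF Y[rule_format]], simplified]
    note Hc = cartan_m_carrier[OF H(1)]
    have "x * X * x = x * H * x + x * ?S * x"
      using S unfolding X by (intro conj_add[OF x(1) Hc]) simp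
    also have "x * ?S * x = finsum (module_mat TYPE(real) ?N ?N) (\<lambda>\<alpha>. x * Y \<alpha> * x) F"
      using S by simp
    finally have "x * X * x \<in> cartan_of n F"
      unfolding cartan_of_def mem_Collect_eq
      using m[OF H] l Y
      by (intro exI[of _ "x * H * x"] exI[of _ "\<lambda>\<alpha>. x * Y \<alpha> * x"]) auto
    then show ?thesis using S Hc by (simp add: X)
  qed
  \<comment> \<open>The preimage of \<open>X\<close> is its own conjugate
    \<open>x * X * x\<close>.\<close>
  have "X \<in> (\<lambda>X. x * X * x) ` cartan_of n F" if "X \<in> cartan_of n F" for X
    using conj_involution[OF x, of X] sub[OF that] by (intro image_eqI[of _ _ "x * X * x"]) auto
  then show ?thesis
    using sub unfolding fixes_subalgebra_def inv_GL_involution[OF x] by blast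
qed

lemma finite_admissible: "F \<in> admissible_systems n \<Longrightarrow> finite F"
  by (auto simp: admissible_systems_def F_sys_def F_sys'_def)

text \<open>The index bounds matter here: \<open>e_fun\<close> reads an unspecified entry outside the matrix.\<close>

lemma admissible_uminus:
  assumes "F \<in> admissible_systems n" "\<alpha> \<in> F" "H \<in> carrier_mat (2 * n + 1) (2 * n + 1)"
  shows "\<alpha> (- H) = - \<alpha> H"
proof -
  have e: "e_fun i (- H) = - e_fun i H" if "i \<le> n" for i
    using that assms(3) by (simp add: e_fun_def)
  show ?thesis
    using assms(1,2) by (auto simp: admissible_systems_def F_sys_def F_sys'_def e)
qed

text \<open>Conjugation by \<open>x\<close> fixes diagonal matrices and J, so it preserves the Lie
  algebra and each root equation. As \<open>x\<close> is symmetric, conjugation also commutes with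
  transposition and thus preserves the compact lines.\<close>

lemma fixes_all_cartans_diag:
  assumes x: "x = monomial_mat (2 * n + 1) \<epsilon> (\<lambda>i. i)" "\<And>i. \<epsilon> i * \<epsilon> i = 1"
    and comm: "J_form n * x = x * J_form n"
  shows "fixes_all_cartans n x"
  unfolding fixes_all_cartans_def
proof
  let ?N = "2 * n + 1"
  fix F assume "F \<in> admissible_systems n"
  have xc: "x \<in> carrier_mat ?N ?N" by (simp add: x)
  have xt: "x\<^sup>T = x" unfolding x(1) by (rule eq_matI) auto
  have xx: "x * x = 1\<^sub>m ?N"
    unfolding x(1)
    by (rule eq_matI) (simp_all add: index_monomial_mult[where M="?N"] x(2) del: index_mult_mat(1))
  note assoc = assoc_mult_mat[where ?n\<^sub>1="?N" and ?n\<^sub>2="?N" and ?n\<^sub>3="?N" and ?n\<^sub>4="?N"]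
  have xH: "x * H = H * x" if "H \<in> cartan_m n" for H
  proof -
    from that obtain d where H: "H = monomial_mat ?N d (\<lambda>i. i)"
      unfolding cartan_m_def mat_diag_monomial by blast
    show ?thesis
      unfolding H x(1)
      by (rule eq_matI) (simp_all add: index_monomial_mult[where M="?N"] del: index_mult_mat(1))
  qed
  have conj_H: "x * H * x = H" if "H \<in> cartan_m n" for H
  proof -
    have "x * H * x = H * (x * x)"
      using xc cartan_m_carrier[OF that] by (simp add: xH[OF that] assoc)
    then show ?thesis using cartan_m_carrier[OF that] by (simp add: xx)
  qed
  \<comment> \<open>Since \<open>x * x\<close> is the identity, conjugation is multiplicative;
    products in the defining equations can be conjugated factor by factor.\<close>
  have conj_mult: "(x * A * x) * (x * B * x) = x * (A * B) * x"
    if "A \<in> carrier_mat ?N ?N" "B \<in> carrier_mat ?N ?N" for A B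
  proof -
    have "(x * A * x) * (x * B * x) = x * A * ((x * x) * (B * x))"
      using that xc by (simp add: assoc)
    then show ?thesis using that xc by (simp add: xx assoc)
  qed
  have conj_J: "x * J_form n * x = J_form n"
  proof -
    have "x * J_form n * x = J_form n * (x * x)"
      using xc J_form_carrier[of n] by (simp add: comm[symmetric] assoc)
    then show ?thesis using J_form_carrier[of n] by (simp add: xx)
  qed
  note conj_add = conj_add[OF xc]
  have conj_uminus: "x * (- A) * x = - (x * A * x)" if "A \<in> carrier_mat ?N ?N" for A
    using that xc by simp
  have conj_smult: "x * (a \<cdot>\<^sub>m A) * x = a \<cdot>\<^sub>m (x * A * x)" if "A \<in> carrier_mat ?N ?N" for A a
    using that xc by (simp add: mult_smult_distrib[where nr="?N" and n="?N" and nc="?N"]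
      mult_smult_assoc_mat[where nr="?N" and n="?N" and nc="?N"])
  have conj_t: "(x * A * x)\<^sup>T = x * A\<^sup>T * x" if "A \<in> carrier_mat ?N ?N" for A
    using that xc by (simp add: transpose_mult[where nr="?N" and n="?N" and nc="?N"] xt assoc)
  have root: "x * X * x \<in> root_space n \<alpha>" if "X \<in> root_space n \<alpha>" for X \<alpha>
  proof -
    have Xc: "X \<in> carrier_mat ?N ?N" and g: "X\<^sup>T * J_form n + J_form n * X = 0\<^sub>m ?N ?N"
      and r: "\<And>H. H \<in> cartan_m n \<Longrightarrow> H * X - X * H = \<alpha> H \<cdot>\<^sub>m X"
      using that by (auto simp: root_space_def lie_g_def)
    have "(x * X * x)\<^sup>T * J_form n + J_form n * (x * X * x)
        = x * (X\<^sup>T * J_form n) * x + x * (J_form n * X) * x"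
      using conj_mult[of "X\<^sup>T" "J_form n"] conj_mult[of "J_form n" X] Xc
      by (simp add: conj_t conj_J)
    also have "\<dots> = x * 0\<^sub>m ?N ?N * x"
      using Xc mult_carrier_mat[OF J_form_carrier Xc] mult_carrier_mat[OF _ J_form_carrier, of "X\<^sup>T"]
      by (subst conj_add[symmetric]) (auto simp: g)
    also have "\<dots> = 0\<^sub>m ?N ?N" using xc by simp
    finally have "x * X * x \<in> lie_g n" using xc Xc by (simp add: lie_g_def)
    moreover have "H * (x * X * x) - (x * X * x) * H = \<alpha> H \<cdot>\<^sub>m (x * X * x)" if H: "H \<in> cartan_m n" for H
    proof -
      note Hc = cartan_m_carrier[OF H]
      have "H * (x * X * x) - (x * X * x) * H = x * (H * X) * x - x * (X * H) * x"
        using conj_mult[of H X] conj_mult[of X H] Xc Hc by (simp add: conj_H[OF H])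
      also have "\<dots> = x * (H * X) * x + - (x * (X * H) * x)"
        using xc Xc Hc by (intro minus_add_uminus_mat[where nr="?N" and nc="?N"]) auto
      also have "\<dots> = x * (H * X + - (X * H)) * x"
        using Xc Hc by (subst conj_add) (auto simp: conj_uminus)
      also have "H * X + - (X * H) = \<alpha> H \<cdot>\<^sub>m X"
        using r[OF H] Xc Hc by (simp add: minus_add_uminus_mat[where nr="?N" and nc="?N"])
      finally show ?thesis using Xc by (simp add: conj_smult)
    qed
    ultimately show ?thesis by (simp add: root_space_def)
  qed
  show "fixes_subalgebra n x (cartan_of n F)"
  proof (rule fixes_cartan_of[OF xc xx finite_admissible])
    fix \<alpha> Y assume "Y \<in> compact_line n \<alpha>"
    then obtain X where X: "X \<in> root_space n \<alpha>" and Y: "Y = X + (- X\<^sup>T)"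
      by (auto simp: compact_line_def)
    have Xc: "X \<in> carrier_mat ?N ?N" using X by (auto simp: root_space_def lie_g_def)
    then have "x * Y * x = x * X * x + (- (x * X * x)\<^sup>T)"
      unfolding Y by (subst conj_add) (auto simp: conj_uminus conj_t)
    then show "x * Y * x \<in> compact_line n \<alpha>"
      using root[OF X] by (auto simp: compact_line_def)
  qed (use \<open>F \<in> admissible_systems n\<close> in \<open>auto simp: conj_H\<close>)
qed

text \<open>Conjugation by \<open>J\<close> is the Cartan involution \<open>X \<mapsto> - X\<^sup>T\<close> of \<open>\<gg>\<close>: it negates \<open>\<mm>\<close> and is the
  identity on the compact lines.\<close>

lemma fixes_all_cartans_J: "fixes_all_cartans n (J_form n)"
  unfolding fixes_all_cartans_def
proof
  let ?N = "2 * n + 1" and ?J = "J_form n"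
  fix F assume F: "F \<in> admissible_systems n"
  note Jc = J_form_carrier[of n]
  note assoc = assoc_mult_mat[where ?n\<^sub>1="?N" and ?n\<^sub>2="?N" and ?n\<^sub>3="?N" and ?n\<^sub>4="?N"]
  have JHJ: "?J * H * ?J = - H" if "H \<in> cartan_m n" for H
  proof -
    from that obtain h where H: "H = monomial_mat ?N
        (\<lambda>i. if i < n then h (i + 1) else if i < 2 * n then - h (i - n + 1) else 0) (\<lambda>i. i)"
      unfolding cartan_m_def mat_diag_monomial by blast
    \<comment> \<open>J exchanges the diagonal blocks h and -h, which amounts to anticommuting with
      \<open>H\<close>.\<close>
    have "?J * H = - (H * ?J)"
    proof (rule eq_matI)
      fix i j assume "i < dim_row (- (H * ?J))" "j < dim_col (- (H * ?J))"
      then have ij: "i < ?N" "j < ?N" by (auto simp: H J_form_monomial)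
      then have J: "J_perm n i < ?N" by (auto simp: J_perm_def)
      show "(?J * H) $$ (i, j) = (- (H * ?J)) $$ (i, j)"
        unfolding J_form_monomial H using ij J
        by (simp add: index_monomial_mult[where M="?N"] del: index_mult_mat(1)) (auto simp: J_perm_def)
    qed (auto simp: H J_form_monomial)
    then have "?J * H * ?J = - (H * (?J * ?J))"
      using Jc cartan_m_carrier[OF that] by (simp add: assoc)
    then show ?thesis using cartan_m_carrier[OF that] by (simp add: J_form_mult_J_form)
  qed
  show "fixes_subalgebra n ?J (cartan_of n F)"
  proof (rule fixes_cartan_of[OF J_form_carrier J_form_mult_J_form finite_admissible[OF F]])
    fix H assume H: "H \<in> cartan_m n" and z: "\<forall>\<alpha>\<in>F. \<alpha> H = 0"
    from H obtain h where "H = mat_diag ?N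
        (\<lambda>i. if i < n then h (i + 1) else if i < 2 * n then - h (i - n + 1) else 0)"
      by (auto simp: cartan_m_def)
    then have "- H = mat_diag ?N
        (\<lambda>i. if i < n then (- h (i + 1)) else if i < 2 * n then - (- h (i - n + 1)) else 0)"
      by (intro eq_matI) (auto simp: mat_diag_def)
    then have "- H \<in> cartan_m n"
      unfolding cartan_m_def by (intro image_eqI[of _ _ "\<lambda>i. - h i"]) auto
    moreover have "\<alpha> (- H) = 0" if "\<alpha> \<in> F" for \<alpha>
      using z that admissible_uminus[OF F that cartan_m_carrier[OF H]] by simp
    ultimately show "?J * H * ?J \<in> cartan_m n \<and> (\<forall>\<alpha>\<in>F. \<alpha> (?J * H * ?J) = 0)"
      by (simp add: JHJ[OF H])
  next
    fix \<alpha> Y assume Y: "Y \<in> compact_line n \<alpha>"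
    then obtain X where X: "X \<in> carrier_mat ?N ?N" and g: "X\<^sup>T * ?J + ?J * X = 0\<^sub>m ?N ?N"
      and YX: "Y = X + (- X\<^sup>T)"
      by (auto simp: compact_line_def root_space_def lie_g_def)
    \<comment> \<open>The Lie algebra equation solved for \<open>?J * X\<close>; multiplying by J on
      the right then yields the Cartan involution.\<close>
    have JX: "?J * X = - (X\<^sup>T * ?J)"
    proof (rule eq_matI)
      fix i j assume "i < dim_row (- (X\<^sup>T * ?J))" "j < dim_col (- (X\<^sup>T * ?J))"
      then have ij: "i < ?N" "j < ?N" using X Jc by auto
      have "(X\<^sup>T * ?J + ?J * X) $$ (i, j) = 0" using ij by (simp add: g)
      then show "(?J * X) $$ (i, j) = (- (X\<^sup>T * ?J)) $$ (i, j)"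
        using ij X Jc by (simp del: index_mult_mat(1))
    qed (use X Jc in auto)
    have JXJ: "?J * X * ?J = - X\<^sup>T"
    proof -
      have "?J * X * ?J = - (X\<^sup>T * (?J * ?J))"
        using X Jc by (simp add: JX assoc)
      then show ?thesis using X by (simp add: J_form_mult_J_form)
    qed
    have "?J * X\<^sup>T * ?J = - X"
    proof -
      have "?J * (?J * X * ?J) * ?J = X"
        by (rule conj_involution[OF J_form_carrier J_form_mult_J_form X])
      then have "- (?J * X\<^sup>T * ?J) = X" unfolding JXJ using X Jc by simp
      then show ?thesis by (metis uminus_uminus_mat)
    qed
    \<comment> \<open>Conjugation by J exchanges the two summands of \<open>Y\<close>, so
      \<open>Y\<close> itself is fixed.\<close>
    then have "?J * (- X\<^sup>T) * ?J = X" using X by simp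
    moreover have "?J * Y * ?J = ?J * X * ?J + ?J * (- X\<^sup>T) * ?J"
      unfolding YX using X by (intro conj_add[OF Jc]) auto
    ultimately have "?J * Y * ?J = - X\<^sup>T + X" by (simp only: JXJ)
    also have "\<dots> = Y" using X unfolding YX by (intro comm_add_mat) auto
    finally show "?J * Y * ?J \<in> compact_line n \<alpha>" using Y by simp
  qed
qed

section \<open>Sign flips as the required elements\<close>

lemma fixes_all_cartans_flip:
  assumes "p < n" "q < n"
  shows "fixes_all_cartans n (flip_mat n p q)"
proof (rule fixes_all_cartans_diag[OF refl])
  let ?N = "2 * n + 1"
  \<comment> \<open>A diagonal matrix commutes with J when its entries agree at \<open>i\<close> and
    \<open>J_perm n i\<close>; \<open>flip_sign\<close> repeats its signs in the second block for
    this reason.\<close>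
  show "J_form n * flip_mat n p q = flip_mat n p q * J_form n"
  proof (rule eq_matI)
    fix i j assume "i < dim_row (flip_mat n p q * J_form n)" "j < dim_col (flip_mat n p q * J_form n)"
    then have ij: "i < ?N" "j < ?N" by (auto simp: J_form_monomial)
    then have J: "J_perm n i < ?N" by (auto simp: J_perm_def)
    show "(J_form n * flip_mat n p q) $$ (i, j) = (flip_mat n p q * J_form n) $$ (i, j)"
      unfolding J_form_monomial using ij J assms
      by (simp add: index_monomial_mult[where M="?N"] del: index_mult_mat(1))
        (auto simp: J_perm_def flip_sign_def)
  qed (auto simp: J_form_monomial)
qed (auto simp: flip_sign_def)

lemma flip_mat_neq_one:
  assumes "p < n"
  shows "flip_mat n p q \<noteq> 1\<^sub>m (2 * n + 1)"
proof
  assume "flip_mat n p q = 1\<^sub>m (2 * n + 1)"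
  then have "flip_mat n p q $$ (p, p) = 1\<^sub>m (2 * n + 1) $$ (p, p)" by simp
  then show False using assms by (simp add: flip_sign_def)
qed

lemma flip_mat_neq_J:
  assumes "p < n"
  shows "flip_mat n p q \<noteq> J_form n"
proof
  assume "flip_mat n p q = J_form n"
  \<comment> \<open>The flip has -1 at this diagonal position, whereas J has 0 because its diagonal
    n by n blocks vanish.\<close>
  then have "flip_mat n p q $$ (p, p) = J_form n $$ (p, p)" by simp
  then show False using assms by (auto simp: flip_sign_def J_form_monomial J_perm_def split: if_splits)
qed

text \<open>The case n = 1 has no further elements: there K is the circle of rotations of the -1
  eigenspace of J, and only the identity and J map the Cartan subalgebra of the empty system to
  itself. For even n the identity is excluded, as it would satisfy the claim trivially.\<close>

theorem proposition4p3:
  fixes n :: nat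
  assumes "n \<ge> 1"
  shows "(odd n \<longrightarrow>
            J_form n \<in> group_K n \<and> J_form n \<noteq> 1\<^sub>m (2 * n + 1) \<and> fixes_all_cartans n (J_form n) \<and>
            (n \<noteq> 1 \<longrightarrow>
               (\<exists>x \<in> group_K n. \<exists>y \<in> group_K n.
                  x \<noteq> y \<and>
                  x \<noteq> 1\<^sub>m (2 * n + 1) \<and> y \<noteq> 1\<^sub>m (2 * n + 1) \<and>
                  x \<noteq> J_form n \<and> y \<noteq> J_form n \<and>
                  fixes_all_cartans n x \<and> fixes_all_cartans n y))) \<and>
         (even n \<longrightarrow>
            (\<exists>x \<in> group_K n. x \<noteq> 1\<^sub>m (2 * n + 1) \<and> fixes_all_cartans n x))"
proof (intro conjI impI)
  assume n: "odd n" "n \<noteq> 1"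
  \<comment> \<open>Three indices are needed: the two flips share index 0 and are told apart by
    their diagonal entries at 1.\<close>
  then have n3: "2 < n" by presburger
  have "flip_mat n 0 1 \<noteq> flip_mat n 0 2"
  proof
    assume "flip_mat n 0 1 = flip_mat n 0 2"
    then have "flip_mat n 0 1 $$ (1, 1) = flip_mat n 0 2 $$ (1, 1)" by simp
    then show False using n3 by (simp add: flip_sign_def)
  qed
  then show "\<exists>x \<in> group_K n. \<exists>y \<in> group_K n. x \<noteq> y \<and>
      x \<noteq> 1\<^sub>m (2 * n + 1) \<and> y \<noteq> 1\<^sub>m (2 * n + 1) \<and> x \<noteq> J_form n \<and> y \<noteq> J_form n \<and>
      fixes_all_cartans n x \<and> fixes_all_cartans n y"
    using n3 by (intro bexI[of _ "flip_mat n 0 1"] bexI[of _ "flip_mat n 0 2"] conjI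
        flip_mat_neq_one flip_mat_neq_J fixes_all_cartans_flip flip_mat_in_group_K) auto
next
  assume "even n"
  with assms have "1 < n" by presburger
  then show "\<exists>x \<in> group_K n. x \<noteq> 1\<^sub>m (2 * n + 1) \<and> fixes_all_cartans n x"
    by (intro bexI[of _ "flip_mat n 0 1"] conjI
        flip_mat_neq_one fixes_all_cartans_flip flip_mat_in_group_K) auto
qed (use assms in \<open>simp_all add: J_form_in_group_K J_form_neq_one[simplified] fixes_all_cartans_J\<close>)

end
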